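(* Let $\mathcal T\in\mathrm{Tree}(N)$ be an $(n,d)$-regular rooted tree, with $n\ge2$. Then for every non-crossing partition $\pi$ of a (nonempty) finite totally ordered set, \[ \alpha_{\mathcal T,\pi}=\left(\frac{d}{n-1}\right)^{I(\pi)}, \] where $I(\pi)$ denotes the number of inner blocks of $\pi$ (and $0^0=1$).
   Context: Trees: $[N]=\{1,\dots,N\}$. A string on $[N]$ is alternating if consecutive letters differ. $\mathcal T_{N,\mathrm{free}}$ is the graph whose vertices are the alternating strings on $[N]$ (including the empty string $\emptyset$), with an edge between $s$ and $js$ whenever $js$ is alternating, rooted at $\emptyset$. $\mathrm{Tree}(N)$ is the set of connected subgraphs containing $\emptyset$, each identified with its vertex set. A rooted tree is $(n,d)$-regular if the root has exactly $n$ neighbors and each other vertex has exactly $d$ children. For such $\mathcal T\in\mathrm{Tree}(N)$, $n$ is the number of one-letter strings in $\mathcal T$. Partitions: $\mathcal{NC}(S)$ is the set of non-crossing partitions of a finite totally ordered set $S$, $|\pi|$ the number of blocks. $W\prec V$ ($V$ nested inside $W$) if there are $j,k\in W$ with $j<v<k$ for all $v\in V$. $\mathrm{chain}(V)=(V,V_1,\dots,V_d)$, where $V\succ V_1\succ\cdots\succ V_d$ are all blocks in which $V$ is nested. A block is outer if it is not nested inside any other block, and inner otherwise. $\mathrm{graph}(\pi)$ is the rooted tree on $\pi\sqcup\{\emptyset\}$ with $\emptyset$ joined to the $\prec$-minimal blocks and $V,W$ joined if $V\prec W$ with no block strictly between. For a coloring $\chi\in[N]^\pi$, the $\chi$-components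 of $\pi$ are the connected components of the graph obtained from $\mathrm{graph}(\pi)$ by deleting the root and all edges between blocks of different colors; each is regarded as a non-crossing partition of the union of its blocks. $\mathrm{red}(s)$ is the string obtained by replacing each run of equal consecutive letters by a single one. $\mathcal X_w(\pi,\mathcal T)$ is the set of $\chi\in[N]^\pi$ with $\mathrm{red}(\chi(V)\chi(V_1)\cdots\chi(V_d))\in\mathcal T$ for every $V\in\pi$ with $\mathrm{chain}(V)=(V,V_1,\dots,V_d)$. For $\mathcal T\in\mathrm{Tree}(N)$ with $n\ge2$ one-letter strings, the coefficients $\alpha_{\mathcal T,\pi}$ are the unique numbers, indexed by non-crossing partitions $\pi$ of finite totally ordered sets, with $\alpha_{\mathcal T,\pi}=1$ if $|\pi|=1$ and \[ \alpha_{\mathcal T,\pi}=\frac1{n^{|\pi|}}\sum_{\chi\in\mathcal X_w(\pi,\mathcal T)}\ \prod_{\chi\text{-components }\pi'}\alpha_{\mathcal T,\pi'} \] for all $\pi$. *)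

theory Defs
  imports Complex_Main "HOL-Library.FuncSet" "HOL-Library.Disjoint_Sets"
begin

text \<open>Undirected graphs are given by a vertex set and a symmetric relation.\<close>

definition connected_subgraph :: "'v set \<Rightarrow> ('v \<times> 'v) set \<Rightarrow> 'v set \<Rightarrow> ('v \<times> 'v) set \<Rightarrow> bool" where
  "connected_subgraph V' E' V E \<longleftrightarrow>
     V' \<subseteq> V \<and> E' \<subseteq> E \<inter> V' \<times> V' \<and> sym E' \<and> (\<forall>x\<in>V'. \<forall>y\<in>V'. (x, y) \<in> E'\<^sup>*)"

definition graph_components :: "'v set \<Rightarrow> ('v \<times> 'v) set \<Rightarrow> 'v set set" where
  "graph_components V E = V // (E \<inter> V \<times> V)\<^sup>*"

definition alternating_strings :: "nat \<Rightarrow> nat list set" where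
  "alternating_strings N = {s. set s \<subseteq> {1..N} \<and> distinct_adj s}"

definition free_tree_edges :: "nat \<Rightarrow> (nat list \<times> nat list) set" where
  "free_tree_edges N = {(s, t). s \<in> alternating_strings N \<and> t \<in> alternating_strings N \<and>
     (\<exists>j. t = j # s \<or> s = j # t)}"

definition Tree :: "nat \<Rightarrow> nat list set set" where
  "Tree N = {T. [] \<in> T \<and>
     (\<exists>E. connected_subgraph T E (alternating_strings N) (free_tree_edges N))}"

text \<open>
  A connected subgraph of the free tree that contains the root \<open>[]\<close> contains, with a vertex
  \<open>j # s\<close>, also its parent \<open>s\<close>.  The children of \<open>s\<close> are thus the vertices \<open>j # s\<close>; those of
  the root are its neighbours.
\<close>

definition children :: "nat list set \<Rightarrow> nat list \<Rightarrow> nat list set" where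
  "children T s = {t \<in> T. \<exists>j. t = j # s}"

definition regular_tree :: "nat list set \<Rightarrow> nat \<Rightarrow> nat \<Rightarrow> bool" where
  "regular_tree T n d \<longleftrightarrow>
     card (children T []) = n \<and> (\<forall>s\<in>T - {[]}. card (children T s) = d)"

definition NC :: "'a::linorder set \<Rightarrow> 'a set set set" where
  "NC S = {\<pi>. partition_on S \<pi> \<and>
     (\<forall>V\<in>\<pi>. \<forall>W\<in>\<pi>. V \<noteq> W \<longrightarrow>
        \<not> (\<exists>i\<in>V. \<exists>j\<in>W. \<exists>k\<in>V. \<exists>l\<in>W. i < j \<and> j < k \<and> k < l))}"

text \<open>\<open>W \<prec> V\<close> means that \<open>V\<close> is nested inside \<open>W\<close>.\<close>

definition nests :: "'a::linorder set \<Rightarrow> 'a set \<Rightarrow> bool" (infix "\<prec>" 50) where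
  "W \<prec> V \<longleftrightarrow> (\<exists>j\<in>W. \<exists>k\<in>W. \<forall>v\<in>V. j < v \<and> v < k)"

definition inner_blocks :: "'a::linorder set set \<Rightarrow> 'a set set" where
  "inner_blocks \<pi> = {V \<in> \<pi>. \<exists>W\<in>\<pi>. W \<prec> V}"

text \<open>The list \<open>V, V\<^sub>1, \<dots>, V\<^sub>d\<close> runs from the innermost block \<open>V\<close> to the outermost one.\<close>

definition block_chain :: "'a::linorder set set \<Rightarrow> 'a set \<Rightarrow> 'a set list" where
  "block_chain \<pi> V =
     V # (THE Ws. set Ws = {W \<in> \<pi>. W \<prec> V} \<and> sorted_wrt (\<lambda>U W. W \<prec> U) Ws)"

text \<open>The vertex \<open>None\<close> is the root, \<open>Some V\<close> is the block \<open>V\<close>.\<close>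

definition partition_graph_edges :: "'a::linorder set set \<Rightarrow> ('a set option \<times> 'a set option) set" where
  "partition_graph_edges \<pi> =
     (let E = {(None, Some V) | V. V \<in> \<pi> \<and> \<not> (\<exists>W\<in>\<pi>. W \<prec> V)} \<union>
              {(Some V, Some W) | V W. V \<in> \<pi> \<and> W \<in> \<pi> \<and> V \<prec> W \<and> \<not> (\<exists>U\<in>\<pi>. V \<prec> U \<and> U \<prec> W)}
      in E \<union> E\<inverse>)"

definition color_components :: "'a::linorder set set \<Rightarrow> ('a set \<Rightarrow> nat) \<Rightarrow> 'a set set set" where
  "color_components \<pi> \<chi> =
     graph_components \<pi> {(V, W). (Some V, Some W) \<in> partition_graph_edges \<pi> \<and> \<chi> V = \<chi> W}"

text \<open>The reduction of a string is \<^const>\<open>remdups_adj\<close>.\<close>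

definition weak_colorings :: "nat \<Rightarrow> 'a::linorder set set \<Rightarrow> nat list set \<Rightarrow> ('a set \<Rightarrow> nat) set" where
  "weak_colorings N \<pi> T =
     {\<chi> \<in> \<pi> \<rightarrow>\<^sub>E {1..N}. \<forall>V\<in>\<pi>. remdups_adj (map \<chi> (block_chain \<pi> V)) \<in> T}"

definition alpha_system :: "nat \<Rightarrow> nat list set \<Rightarrow> ('a::linorder set set \<Rightarrow> real) \<Rightarrow> bool" where
  "alpha_system N T \<alpha> \<longleftrightarrow>
     (\<forall>S \<pi>. finite S \<longrightarrow> \<pi> \<in> NC S \<longrightarrow>
        (card \<pi> = 1 \<longrightarrow> \<alpha> \<pi> = 1) \<and>
        \<alpha> \<pi> = 1 / real (card {s \<in> T. length s = 1}) ^ card \<pi> *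
          (\<Sum>\<chi>\<in>weak_colorings N \<pi> T. \<Prod>\<pi>'\<in>color_components \<pi> \<chi>. \<alpha> \<pi>'))"

text \<open>
  The index set of the family consists of the non-crossing partitions of the finite subsets of
  the type \<open>'a\<close>, which contains the components of each of its members.  Outside this index set
  the function is fixed to \<^const>\<open>undefined\<close>, so that the description is definite.
\<close>

definition alpha :: "nat \<Rightarrow> nat list set \<Rightarrow> 'a::linorder set set \<Rightarrow> real" where
  "alpha N T = (THE \<alpha>. \<alpha> \<in> extensional (\<Union>S\<in>{S. finite S}. NC S) \<and> alpha_system N T \<alpha>)"

end

theory Submission imports Defs begin

text \<open>
  Put \<open>q = d / (n - 1)\<close>. A component of a colored partition has a single outer block, and its inner
  blocks are exactly those that have the color of their parent. Hence \<open>q ^ I\<close>, multiplied over the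
  components, gives a factor \<open>q\<close> for each block colored like its parent. Color the blocks from the
  outside in: an outer block has \<open>n\<close> admissible colors; an inner block either repeats the color of
  its parent, with weight \<open>q\<close>, or takes one of \<open>d\<close> other colors, in total \<open>q + d = q n\<close>. The weighted
  sum is therefore \<open>n ^ card \<pi> * q ^ I\<close>, so \<open>q ^ I\<close> solves the system, whose solution is unique.
\<close>

section \<open>The nesting order\<close>

text \<open>By asymmetry no other entry can precede the head, so both lists start alike; asymmetry
  also excludes repetitions, so the tails have equal sets. This is the uniqueness behind the
  definite description in \<open>block_chain\<close>.\<close>

lemma sorted_wrt_set_unique:
  assumes "asymp R" and "sorted_wrt R xs" and "sorted_wrt R ys" and "set xs = set ys"
  shows "xs = ys"
  using assms(2-4)
proof (induction xs arbitrary: ys)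
  case Nil
  then show ?case by simp
next
  case (Cons x xs)
  then obtain y zs where ys: "ys = y # zs"
    by (cases ys) auto
  have x: "\<forall>z\<in>set xs. R x z" and y: "\<forall>z\<in>set zs. R y z"
    using Cons.prems ys by auto
  have "x \<in> insert y (set zs)" "y \<in> insert x (set xs)"
    using Cons.prems(3) ys by auto
  then have "x = y"
    using x y asympD[OF assms(1)] by blast
  moreover have "x \<notin> set xs" "y \<notin> set zs"
    using x y asympD[OF assms(1), of x x] asympD[OF assms(1), of y y] by blast+
  ultimately have "set xs = set zs"
    using Cons.prems(3) ys by (simp add: insert_ident)
  then show ?case
    using Cons.IH[of zs] Cons.prems ys \<open>x = y\<close> by simp
qed

lemma nests_trans: "W \<prec> U \<Longrightarrow> U \<prec> V \<Longrightarrow> W \<prec> V"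
  unfolding nests_def by (meson less_trans)

lemma nests_irrefl: "\<not> W \<prec> W"
  unfolding nests_def by blast

lemma nests_asym: "V \<prec> W \<Longrightarrow> \<not> W \<prec> V"
  using nests_trans nests_irrefl by blast

section \<open>Basic facts on non-crossing partitions\<close>

lemma NC_iff:
  "\<pi> \<in> NC S \<longleftrightarrow> partition_on S \<pi> \<and>
     (\<forall>V\<in>\<pi>. \<forall>W\<in>\<pi>. V \<noteq> W \<longrightarrow>
        \<not> (\<exists>i\<in>V. \<exists>j\<in>W. \<exists>k\<in>V. \<exists>l\<in>W. i < j \<and> j < k \<and> k < l))"
  by (simp add: NC_def)

lemma NC_crossing:
  assumes "\<pi> \<in> NC S" and "V \<in> \<pi>" "W \<in> \<pi>" "V \<noteq> W"
    and "i \<in> V" "j \<in> W" "k \<in> V" "l \<in> W" and "i < j" "j < k" "k < l"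
  shows False
  using assms(1)[unfolded NC_iff, THEN conjunct2, rule_format, OF assms(2-4)] assms(5-) by metis

lemma NC_subset:
  assumes "\<pi> \<in> NC S" and "C \<subseteq> \<pi>"
  shows "C \<in> NC (\<Union>C)"
  unfolding NC_iff
proof (intro conjI ballI impI notI)
  have "disjoint \<pi>" "{} \<notin> \<pi>"
    using assms(1) by (auto simp: NC_iff partition_on_def)
  then show "partition_on (\<Union>C) C"
    using assms(2) pairwise_subset[of disjnt \<pi> C] by (auto simp: partition_on_def)
next
  fix V W
  assume "V \<in> C" "W \<in> C" "V \<noteq> W"
    and cross: "\<exists>i\<in>V. \<exists>j\<in>W. \<exists>k\<in>V. \<exists>l\<in>W. i < j \<and> j < k \<and> k < l"
  then have VW: "V \<in> \<pi>" "W \<in> \<pi>" "V \<noteq> W"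
    using assms(2) by auto
  from cross obtain i j k l where "i \<in> V" "j \<in> W" "k \<in> V" "l \<in> W" "i < j" "j < k" "k < l"
    by (elim bexE conjE)
  with NC_crossing[OF assms(1) VW] show False .
qed

lemma finite_NC:
  assumes "\<pi> \<in> NC S" and "finite S"
  shows "finite \<pi>"
  using assms by (auto simp: NC_iff intro: finite_elements)

lemma NC_Union: "\<pi> \<in> NC S \<Longrightarrow> \<Union>\<pi> = S"
  by (simp add: NC_iff partition_on_def)

lemma NC_disjoint:
  assumes "\<pi> \<in> NC S" and "V \<in> \<pi>" "W \<in> \<pi>" "V \<noteq> W"
  shows "V \<inter> W = {}"
proof -
  have "disjoint \<pi>"
    using assms(1) by (simp add: NC_iff partition_on_def)
  then show ?thesis
    using assms(2-4) by (rule disjointD)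
qed

lemma NC_nonempty: "\<pi> \<in> NC S \<Longrightarrow> V \<in> \<pi> \<Longrightarrow> V \<noteq> {}"
  by (auto simp: NC_iff partition_on_def)

text \<open>This makes the blocks around \<open>V\<close> a chain. Two of them have points on both
  sides of a point \<open>v\<close> of \<open>V\<close>; the one whose chosen left point lies
  further left must enclose the other, or the two would cross.\<close>

lemma nests_linear:
  assumes "\<pi> \<in> NC S" and "V \<in> \<pi>" "W \<in> \<pi>" "U \<in> \<pi>" and "W \<prec> V" "U \<prec> V"
  shows "W = U \<or> W \<prec> U \<or> U \<prec> W"
proof -
  have *: "A \<prec> B" if AB: "A \<in> \<pi>" "B \<in> \<pi>" "A \<noteq> B" "j \<in> A" "k \<in> A" "j' \<in> B" "k' \<in> B"
    "j < v" "v < k" "j' < v" "v < k'" "j < j'" for A B j k j' k' v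
  proof -
    have disj: "A \<inter> B = {}"
      using NC_disjoint[OF assms(1)] AB by blast
    \<comment> \<open>A point \<open>b\<close> beyond \<open>j\<close> or \<open>k\<close> would
      give the crossing b < j < j' < k or j < j' < k < b.\<close>
    have "j < b \<and> b < k" if b: "b \<in> B" for b
    proof -
      have ne: "b \<noteq> j" "b \<noteq> k" using disj AB b by auto
      have "j' < k"
        using AB by (metis less_trans)
      have "\<not> b < j"
        using NC_crossing[OF assms(1), of B A b j j' k] AB b \<open>j' < k\<close> by blast
      have "\<not> b > k"
        using NC_crossing[OF assms(1), of A B j j' k b] AB b \<open>j' < k\<close> by blast
      with ne \<open>\<not> b < j\<close> show ?thesis by auto
    qed
    then show ?thesis
      unfolding nests_def using AB by blast
  qed
  have "V \<noteq> {}"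
    using NC_nonempty[OF assms(1,2)] .
  then obtain v where "v \<in> V" by blast
  then obtain j k j' k' where jk: "j \<in> W" "k \<in> W" "j < v" "v < k"
    "j' \<in> U" "k' \<in> U" "j' < v" "v < k'"
    using assms(5,6) unfolding nests_def by blast
  show ?thesis
  proof (cases "W = U")
    case False
    then have "W \<inter> U = {}"
      using NC_disjoint[OF assms(1,3,4)] by blast
    then have "j \<noteq> j'" using jk by auto
    then consider "j < j'" | "j' < j" by (meson neqE)
    then show ?thesis
    proof cases
      case 1
      then have "W \<prec> U"
        using *[of W U j k j' k' v] jk assms(3,4) False by metis
      then show ?thesis by simp
    next
      case 2
      then have "U \<prec> W"
        using *[of U W j' k' j k v] jk assms(3,4) False by metis
      then show ?thesis by simp
    qed
  qed simp
qed

lemma nests_maximal: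
  fixes A :: "'a::linorder set set"
  assumes "finite A" and "A \<noteq> {}"
  obtains P where "P \<in> A" and "\<And>U. U \<in> A \<Longrightarrow> \<not> P \<prec> U"
proof -
  have "asymp_on A (\<prec>)"
    by (rule asymp_onI) (rule nests_asym)
  moreover have "transp_on A (\<prec>)"
    by (rule transp_onI) (rule nests_trans)
  ultimately have "\<exists>P\<in>A. \<forall>U\<in>A. \<not> P \<prec> U"
    using Finite_Set.bex_max_element[of A "(\<prec>)"] assms nests_irrefl by fast
  then show thesis using that by fast
qed

text \<open>\<open>P\<close> is the parent of \<open>V\<close> in the rooted tree
  graph(\<pi>).\<close>

definition covers :: "'a::linorder set set \<Rightarrow> 'a set \<Rightarrow> 'a set \<Rightarrow> bool" where
  "covers \<pi> P V \<longleftrightarrow> P \<in> \<pi> \<and> V \<in> \<pi> \<and> P \<prec> V \<and> \<not> (\<exists>U\<in>\<pi>. P \<prec> U \<and> U \<prec> V)"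

lemma covers_exists:
  assumes "finite \<pi>" and "V \<in> inner_blocks \<pi>"
  obtains P where "covers \<pi> P V"
proof -
  let ?A = "{W \<in> \<pi>. W \<prec> V}"
  have "finite ?A" "?A \<noteq> {}"
    using assms by (auto simp: inner_blocks_def)
  then obtain P where "P \<in> ?A" and max: "\<And>U. U \<in> ?A \<Longrightarrow> \<not> P \<prec> U"
    using nests_maximal[of ?A] by metis
  then have "covers \<pi> P V"
    using assms(2) by (auto simp: covers_def inner_blocks_def dest: max)
  then show thesis by (rule that)
qed

lemma covers_below:
  assumes "\<pi> \<in> NC S" and "covers \<pi> P V" and "W \<in> \<pi>" and "W \<prec> V"
  shows "W = P \<or> W \<prec> P"
  using nests_linear[OF assms(1), of V W P] assms unfolding covers_def by blast

lemma covers_unique: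
  assumes "\<pi> \<in> NC S" and "covers \<pi> P V" and "covers \<pi> Q V"
  shows "P = Q"
  using nests_linear[OF assms(1), of V P Q] assms unfolding covers_def by blast

section \<open>Chains\<close>

lemma ancestors_covers:
  assumes "\<pi> \<in> NC S" and "covers \<pi> P V"
  shows "{W \<in> \<pi>. W \<prec> V} = insert P {W \<in> \<pi>. W \<prec> P}"
  using covers_below[OF assms] assms(2) nests_trans unfolding covers_def by blast

lemma block_chain_unique:
  assumes "set Ws = {W \<in> \<pi>. W \<prec> V}" and "sorted_wrt (\<lambda>U W. W \<prec> U) Ws"
  shows "block_chain \<pi> V = V # Ws"
proof -
  have "asymp (\<lambda>U W. W \<prec> (U :: 'a set))"
    by (rule asymp_onI) (rule nests_asym)
  then have "(THE Ws. set Ws = {W \<in> \<pi>. W \<prec> V} \<and> sorted_wrt (\<lambda>U W. W \<prec> U) Ws) = Ws"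
    using assms by (auto intro!: the_equality elim: sorted_wrt_set_unique)
  then show ?thesis by (simp add: block_chain_def)
qed

lemma block_chain_ne: "block_chain \<pi> V \<noteq> []"
  by (simp add: block_chain_def)

lemma block_chain_outer:
  assumes "V \<in> \<pi> - inner_blocks \<pi>"
  shows "block_chain \<pi> V = [V]"
  using assms by (intro block_chain_unique) (auto simp: inner_blocks_def)

text \<open>Induction on the number of blocks around \<open>V\<close>: the list for the parent, with
  the parent put in front, serves for \<open>V\<close>.\<close>

lemma block_chain_exists:
  assumes "\<pi> \<in> NC S" and "finite \<pi>" and "V \<in> \<pi>"
  shows "\<exists>Ws. set Ws = {W \<in> \<pi>. W \<prec> V} \<and> sorted_wrt (\<lambda>U W. W \<prec> U) Ws"
  using assms(3)
proof (induction "card {W \<in> \<pi>. W \<prec> V}" arbitrary: V rule: less_induct)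
  case less
  show ?case
  proof (cases "V \<in> inner_blocks \<pi>")
    case True
    then obtain P where P: "covers \<pi> P V"
      using covers_exists assms(2) by blast
    note anc = ancestors_covers[OF assms(1) P]
    have "card {W \<in> \<pi>. W \<prec> P} < card {W \<in> \<pi>. W \<prec> V}"
      using anc nests_irrefl assms(2) by (intro psubset_card_mono) auto
    then obtain Ws where Ws: "set Ws = {W \<in> \<pi>. W \<prec> P}" "sorted_wrt (\<lambda>U W. W \<prec> U) Ws"
      using less.hyps[of P] P unfolding covers_def by blast
    then show ?thesis
      using anc by (intro exI[of _ "P # Ws"]) auto
  next
    case False
    then show ?thesis
      using less.prems by (intro exI[of _ "[]"]) (auto simp: inner_blocks_def)
  qed
qed

lemma block_chain_covers:
  assumes "\<pi> \<in> NC S" and "finite \<pi>" and "covers \<pi> P V"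
  shows "block_chain \<pi> V = V # block_chain \<pi> P"
proof -
  obtain Ws where Ws: "set Ws = {W \<in> \<pi>. W \<prec> P}" "sorted_wrt (\<lambda>U W. W \<prec> U) Ws"
    using block_chain_exists[OF assms(1,2)] assms(3) unfolding covers_def by blast
  then have "block_chain \<pi> P = P # Ws" by (rule block_chain_unique)
  moreover have "block_chain \<pi> V = V # P # Ws"
    using Ws ancestors_covers[OF assms(1,3)] by (intro block_chain_unique) auto
  ultimately show ?thesis by simp
qed

lemma set_block_chain:
  assumes "\<pi> \<in> NC S" and "finite \<pi>" and "V \<in> \<pi>"
  shows "set (block_chain \<pi> V) = insert V {W \<in> \<pi>. W \<prec> V}"
  using block_chain_exists[OF assms] block_chain_unique[of _ \<pi> V] by fastforce

section \<open>Components\<close>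

definition same_color_parent :: "'a::linorder set set \<Rightarrow> ('a set \<Rightarrow> nat) \<Rightarrow> 'a set \<Rightarrow> bool" where
  "same_color_parent \<pi> \<chi> V \<longleftrightarrow> (\<exists>P. covers \<pi> P V \<and> \<chi> P = \<chi> V)"

definition color_edges :: "'a::linorder set set \<Rightarrow> ('a set \<Rightarrow> nat) \<Rightarrow> ('a set \<times> 'a set) set" where
  "color_edges \<pi> \<chi> = {(V, W). (covers \<pi> V W \<or> covers \<pi> W V) \<and> \<chi> V = \<chi> W}"

lemma color_components_eq: "color_components \<pi> \<chi> = \<pi> // (color_edges \<pi> \<chi>)\<^sup>*"
proof -
  have "{(V, W). (Some V, Some W) \<in> partition_graph_edges \<pi> \<and> \<chi> V = \<chi> W} \<inter> \<pi> \<times> \<pi>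
      = color_edges \<pi> \<chi>"
    by (auto simp: color_edges_def partition_graph_edges_def Let_def covers_def)
  then show ?thesis
    by (simp add: color_components_def graph_components_def)
qed

lemma color_edges_sym: "sym ((color_edges \<pi> \<chi>)\<^sup>*)"
  by (intro sym_rtrancl) (auto simp: sym_def color_edges_def)

lemma color_edges_rtrancl_in:
  assumes "(V, W) \<in> (color_edges \<pi> \<chi>)\<^sup>*" and "V \<in> \<pi>"
  shows "W \<in> \<pi> \<and> \<chi> W = \<chi> V"
  using assms by (induction rule: rtrancl_induct) (auto simp: color_edges_def covers_def)

lemma color_components_partition: "partition_on \<pi> (color_components \<pi> \<chi>)"
proof -
  \<comment> \<open>The reflexive closure also relates sets outside \<pi>, so it is cut down to
    \<pi>. Paths that start in \<pi> stay there, so the quotient does not change.\<close>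
  let ?R = "(color_edges \<pi> \<chi>)\<^sup>* \<inter> \<pi> \<times> \<pi>"
  have "equiv \<pi> ?R"
    using color_edges_sym[of \<pi> \<chi>]
    by (auto intro!: equivI refl_onI symI transI dest: symD intro: rtrancl_trans)
  moreover have "\<pi> // ?R = color_components \<pi> \<chi>"
    unfolding color_components_eq quotient_def using color_edges_rtrancl_in[of _ _ \<pi> \<chi>] by fastforce
  ultimately show ?thesis
    using partition_on_quotient by metis
qed

lemma color_components_rtrancl:
  assumes "C \<in> color_components \<pi> \<chi>" and "V \<in> C" and "W \<in> C"
  shows "(V, W) \<in> (color_edges \<pi> \<chi>)\<^sup>*"
  using assms color_edges_sym[of \<pi> \<chi>] unfolding color_components_eq quotient_def
  by (auto dest: symD intro: rtrancl_trans)

lemma color_components_closed: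
  assumes "C \<in> color_components \<pi> \<chi>" and "V \<in> C" and "(V, W) \<in> color_edges \<pi> \<chi>"
  shows "W \<in> C"
  using assms unfolding color_components_eq quotient_def by (auto intro: rtrancl_into_rtrancl)

text \<open>A block without a parent of its own color lies on top of its whole component, since
  every path that starts at it leads further inside.\<close>

lemma reachable_below:
  assumes "\<pi> \<in> NC S" and V: "V \<in> \<pi>" and "\<not> same_color_parent \<pi> \<chi> V"
    and "(V, X) \<in> (color_edges \<pi> \<chi>)\<^sup>*"
  shows "X = V \<or> V \<prec> X"
  using assms(4)
proof (induction rule: rtrancl_induct)
  case (step Y Z)
  then consider "covers \<pi> Y Z" | "covers \<pi> Z Y" "\<chi> Z = \<chi> Y"
    unfolding color_edges_def by auto
  then show ?case
  proof cases
    case 1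
    then show ?thesis
      using step.IH nests_trans unfolding covers_def by blast
  next
    case 2
    \<comment> \<open>The edge climbs from \<open>Y\<close> to its parent \<open>Z\<close>. Since
      \<open>V\<close> has no parent of its color, \<open>Y\<close> is not \<open>V\<close>; so
      \<open>V\<close> lies around \<open>Y\<close>, and hence is \<open>Z\<close> or lies around
      \<open>Z\<close>.\<close>
    then have "V \<prec> Y"
      using step.IH assms(3) unfolding same_color_parent_def by blast
    then show ?thesis
      using covers_below[OF assms(1) 2(1) V] by blast
  qed
qed simp

text \<open>If \<open>V\<close> is nested in a block \<open>W\<close> of \<open>C\<close> but has no
  parent of its own color, \<open>reachable_below\<close> puts \<open>W\<close> inside
  \<open>V\<close>, a contradiction. Conversely, a parent of the same color is adjacent to
  \<open>V\<close> and so belongs to \<open>C\<close>.\<close>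

lemma inner_blocks_component:
  assumes "\<pi> \<in> NC S" and "C \<in> color_components \<pi> \<chi>"
  shows "inner_blocks C = {V \<in> C. same_color_parent \<pi> \<chi> V}"
proof -
  have "V \<in> inner_blocks C \<longleftrightarrow> same_color_parent \<pi> \<chi> V" if V: "V \<in> C" for V
  proof
    assume "V \<in> inner_blocks C"
    then obtain W where W: "W \<in> C" "W \<prec> V" unfolding inner_blocks_def by blast
    have "V \<in> \<pi>"
      using color_components_partition[of \<pi> \<chi>] assms(2) V unfolding partition_on_def by blast
    with W show "same_color_parent \<pi> \<chi> V"
      using reachable_below[OF assms(1)] color_components_rtrancl[OF assms(2) V W(1)]
        nests_asym nests_irrefl by blast
  next
    assume "same_color_parent \<pi> \<chi> V"
    then obtain P where P: "covers \<pi> P V" "\<chi> P = \<chi> V"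
      unfolding same_color_parent_def by blast
    then have "P \<in> C"
      using color_components_closed[OF assms(2) V] by (auto simp: color_edges_def)
    then show "V \<in> inner_blocks C"
      using V P unfolding inner_blocks_def covers_def by blast
  qed
  then show ?thesis unfolding inner_blocks_def by blast
qed

text \<open>Turns the weight of a coloring into a product over single blocks, so that colors can be
  summed out one block at a time.\<close>

lemma prod_color_components:
  fixes q :: "'b::comm_semiring_1"
  assumes "\<pi> \<in> NC S" and "finite \<pi>"
  shows "(\<Prod>C\<in>color_components \<pi> \<chi>. q ^ card (inner_blocks C))
       = (\<Prod>V\<in>\<pi>. if same_color_parent \<pi> \<chi> V then q else 1)"
proof -
  note part = color_components_partition[of \<pi> \<chi>]
  have fin: "finite C" if "C \<in> color_components \<pi> \<chi>" for C
    using that part assms(2) unfolding partition_on_def by (metis Union_upper finite_subset)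
  have "(\<Prod>V\<in>\<pi>. if same_color_parent \<pi> \<chi> V then q else 1)
      = (\<Prod>C\<in>color_components \<pi> \<chi>. \<Prod>V\<in>C. if same_color_parent \<pi> \<chi> V then q else 1)"
    using part prod.Union_disjoint[of "color_components \<pi> \<chi>"] fin
    unfolding partition_on_def disjoint_def by auto
  also have "\<dots> = (\<Prod>C\<in>color_components \<pi> \<chi>. q ^ card (inner_blocks C))"
    using fin by (intro prod.cong refl)
      (simp add: inner_blocks_component[OF assms(1)] prod.If_cases Int_def)
  finally show ?thesis by simp
qed

section \<open>Removing an innermost block\<close>

lemma block_chain_Cons:
  assumes "\<pi> \<in> NC S" and "finite \<pi>" and "V \<in> \<pi>"
  obtains Ws where "block_chain \<pi> V = V # Ws" and "set Ws = {W \<in> \<pi>. W \<prec> V}"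
  using block_chain_exists[OF assms] block_chain_unique[of _ \<pi> V] by metis

text \<open>The parent is the second entry of the chain, so the condition becomes one on the color
  string. For an outer block the tail is empty and its \<open>hd\<close> carries no information,
  hence the conjunct on \<open>inner_blocks\<close>.\<close>

lemma same_color_parent_iff_hd:
  assumes "\<pi> \<in> NC S" and "finite \<pi>" and "V \<in> \<pi>"
  shows "same_color_parent \<pi> \<chi> V \<longleftrightarrow>
    V \<in> inner_blocks \<pi> \<and> \<chi> V = hd (map \<chi> (tl (block_chain \<pi> V)))"
proof (cases "V \<in> inner_blocks \<pi>")
  case True
  then obtain P where P: "covers \<pi> P V"
    using covers_exists assms(2) by blast
  have "block_chain \<pi> V = V # block_chain \<pi> P"
    using block_chain_covers[OF assms(1,2) P] .
  moreover have "same_color_parent \<pi> \<chi> V \<longleftrightarrow> \<chi> P = \<chi> V"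
    using P covers_unique[OF assms(1) P] unfolding same_color_parent_def by blast
  ultimately show ?thesis
    using True by (auto simp: block_chain_def[of \<pi> P])
next
  case False
  then show ?thesis
    unfolding same_color_parent_def covers_def inner_blocks_def by blast
qed

text \<open>No block lies inside \<open>V\<close>, so \<open>V\<close> occurs only in its own chain
  and is the parent of no block: deleting it leaves the chains, parents and color constraints of all
  other blocks unchanged.\<close>

locale innermost_block =
  fixes S :: "'a::linorder set" and \<pi> :: "'a set set" and V :: "'a set"
  assumes NC: "\<pi> \<in> NC S" and finite: "finite \<pi>" and block: "V \<in> \<pi>"
    and innermost: "\<And>U. U \<in> \<pi> \<Longrightarrow> \<not> V \<prec> U"
begin

abbreviation "\<pi>' \<equiv> \<pi> - {V}"

definition ancestors :: "'a set list" where
  "ancestors = tl (block_chain \<pi> V)"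

lemma block_chain_ancestors: "block_chain \<pi> V = V # ancestors"
  unfolding ancestors_def block_chain_def by simp

lemma set_ancestors: "set ancestors = {W \<in> \<pi>. W \<prec> V}"
  using block_chain_Cons[OF NC finite block] block_chain_ancestors by (metis list.inject)

lemma ancestors_subset: "set ancestors \<subseteq> \<pi>'"
  using set_ancestors nests_irrefl by auto

lemma block_chain_remove:
  assumes "U \<in> \<pi>'"
  shows "block_chain \<pi>' U = block_chain \<pi> U"
proof -
  have "{W \<in> \<pi>'. W \<prec> U} = {W \<in> \<pi>. W \<prec> U}"
    using assms innermost by auto
  then show ?thesis by (simp add: block_chain_def)
qed

lemma block_chain_remove_subset:
  assumes "U \<in> \<pi>'"
  shows "set (block_chain \<pi> U) \<subseteq> \<pi>'"
  using assms set_block_chain[OF NC finite, of U] innermost[of U] by auto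

lemma covers_remove:
  assumes "U \<in> \<pi>'"
  shows "covers \<pi>' P U \<longleftrightarrow> covers \<pi> P U"
  using assms innermost unfolding covers_def by blast

lemma same_color_parent_remove:
  assumes "U \<in> \<pi>'" and "\<And>W. W \<in> \<pi>' \<Longrightarrow> \<chi>' W = \<chi> W"
  shows "same_color_parent \<pi>' \<chi>' U \<longleftrightarrow> same_color_parent \<pi> \<chi> U"
proof -
  have "covers \<pi> P U \<Longrightarrow> \<chi>' P = \<chi> P" for P
    using covers_remove[OF assms(1), of P] assms(2) unfolding covers_def by blast
  then show ?thesis
    using covers_remove[OF assms(1)] assms unfolding same_color_parent_def by metis
qed

lemma inner_blocks_remove: "inner_blocks \<pi>' = inner_blocks \<pi> - {V}"
  using innermost unfolding inner_blocks_def by blast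

lemma weak_colorings_remove:
  assumes "\<And>W. W \<in> \<pi>' \<Longrightarrow> \<chi>' W = \<chi> W" and "\<chi> \<in> extensional \<pi>" "\<chi>' \<in> extensional \<pi>'"
  shows "\<chi> \<in> weak_colorings N \<pi> T \<longleftrightarrow>
    \<chi>' \<in> weak_colorings N \<pi>' T \<and> \<chi> V \<in> {1..N} \<and> remdups_adj (\<chi> V # map \<chi>' ancestors) \<in> T"
proof -
  have agree: "map \<chi> Ws = map \<chi>' Ws" if "set Ws \<subseteq> \<pi>'" for Ws
    unfolding map_eq_conv
  proof
    fix W assume "W \<in> set Ws"
    then have "W \<in> \<pi>'" using that by blast
    then show "\<chi> W = \<chi>' W" using assms(1) by simp
  qed
  have split: "(\<forall>U\<in>\<pi>. P U) \<longleftrightarrow> P V \<and> (\<forall>U\<in>\<pi>'. P U)" for P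
    using block by blast
  have "map \<chi> (block_chain \<pi> U) = map \<chi>' (block_chain \<pi>' U)" if "U \<in> \<pi>'" for U
    using agree[OF block_chain_remove_subset[OF that]] block_chain_remove[OF that] by simp
  then have "(\<forall>U\<in>\<pi>. remdups_adj (map \<chi> (block_chain \<pi> U)) \<in> T) \<longleftrightarrow>
      remdups_adj (\<chi> V # map \<chi>' ancestors) \<in> T \<and>
      (\<forall>U\<in>\<pi>'. remdups_adj (map \<chi>' (block_chain \<pi>' U)) \<in> T)"
    unfolding split block_chain_ancestors list.map agree[OF ancestors_subset] by simp
  moreover have "\<chi> \<in> \<pi> \<rightarrow>\<^sub>E {1..N} \<longleftrightarrow> \<chi>' \<in> \<pi>' \<rightarrow>\<^sub>E {1..N} \<and> \<chi> V \<in> {1..N}"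
    unfolding PiE_iff split using assms by auto
  ultimately show ?thesis
    by (simp add: weak_colorings_def) blast
qed

text \<open>A coloring of \<pi> amounts to one of \<open>\<pi>'\<close> together with a color for
  \<open>V\<close> that is admissible given the colors of its ancestors.\<close>

lemma sum_weak_colorings_remove:
  "(\<Sum>\<chi>\<in>weak_colorings N \<pi> T. f \<chi>) =
   (\<Sum>\<chi>\<in>weak_colorings N \<pi>' T. \<Sum>c\<in>{c \<in> {1..N}. remdups_adj (c # map \<chi> ancestors) \<in> T}. f (\<chi>(V := c)))"
proof -
  let ?W = "weak_colorings N \<pi> T" and ?W' = "weak_colorings N \<pi>' T"
  let ?A = "\<lambda>\<chi>. {c \<in> {1..N}. remdups_adj (c # map \<chi> ancestors) \<in> T}"
  have fin: "finite ?W'" "finite (?A \<chi>)" for \<chi>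
    unfolding weak_colorings_def using finite by (simp_all add: finite_PiE)
  have ext: "\<chi> \<in> extensional \<rho>" if "\<chi> \<in> weak_colorings N \<rho> T" for \<chi> and \<rho> :: "'a set set"
    using that unfolding weak_colorings_def PiE_def by blast
  have "(\<Sum>\<chi>\<in>?W. f \<chi>) = (\<Sum>(\<chi>, c)\<in>Sigma ?W' ?A. f (\<chi>(V := c)))"
  \<comment> \<open>Restriction to \<open>\<pi>'\<close> is the update of \<open>V\<close> to
    \<open>undefined\<close>, the value of an extensional function off its domain.\<close>
  proof (rule sum.reindex_bij_witness[where i = "\<lambda>(\<chi>, c). \<chi>(V := c)" and
      j = "\<lambda>\<chi>. (\<chi>(V := undefined), \<chi> V)"], goal_cases)
    case (2 \<chi>)
    have "\<chi>(V := undefined) \<in> extensional \<pi>'"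
      using ext[OF 2] by (auto simp: extensional_def)
    then show ?case
      using weak_colorings_remove[of "\<chi>(V := undefined)" \<chi>] ext[OF 2] 2 by auto
  next
    case (3 p)
    then have "fst p V = undefined"
      using ext[of "fst p" \<pi>'] by (auto simp: extensional_def)
    then show ?case by (auto simp: case_prod_unfold prod_eq_iff)
  next
    case (4 p)
    have "fst p \<in> extensional \<pi>'" using 4 ext[of "fst p" \<pi>'] by auto
    moreover from this have "(fst p)(V := snd p) \<in> extensional \<pi>"
      using block by (auto simp: extensional_def)
    ultimately show ?case
      using weak_colorings_remove[of "fst p" "(fst p)(V := snd p)"] 4 by auto
  qed (auto simp: case_prod_unfold)
  also have "\<dots> = (\<Sum>\<chi>\<in>?W'. \<Sum>c\<in>?A \<chi>. f (\<chi>(V := c)))"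
    using fin by (intro sum.Sigma[symmetric]) auto
  finally show ?thesis .
qed

end

section \<open>Colorings by a regular tree\<close>

locale rooted_regular_tree =
  fixes N n d :: nat and T :: "nat list set"
  assumes Tree: "T \<in> Tree N" and regular: "regular_tree T n d" and n_ge_2: "n \<ge> 2"
begin

definition ratio :: real where
  "ratio = real d / (real n - 1)"

text \<open>The identity that fixes the value of \<open>ratio\<close>: repeating the parent's color,
  with weight \<open>ratio\<close>, and \<open>d\<close> new colors of weight 1 together amount to
  \<open>n\<close> times \<open>ratio\<close>.\<close>

lemma ratio_balance: "ratio + real d = ratio * real n"
  using n_ge_2 by (simp add: ratio_def field_simps)

lemma T_alternating: "T \<subseteq> alternating_strings N"
  using Tree by (auto simp: Tree_def connected_subgraph_def)

lemma card_child_colors: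
  "card {c \<in> {1..N}. c # s \<in> T} = card (children T s)"
proof -
  have "children T s = (\<lambda>c. c # s) ` {c \<in> {1..N}. c # s \<in> T}"
    using T_alternating by (auto simp: children_def alternating_strings_def)
  moreover have "inj (\<lambda>c. c # s)" by (simp add: inj_def)
  ultimately show ?thesis by (metis card_image subset_UNIV inj_on_subset)
qed

lemma card_one_letter: "card {s \<in> T. length s = 1} = n"
proof -
  have "{s \<in> T. length s = 1} = children T []"
    by (auto simp: children_def length_Suc_conv)
  then show ?thesis
    using regular by (simp add: regular_tree_def)
qed

lemma card_root_colors: "card {c \<in> {1..N}. [c] \<in> T} = n"
  using card_child_colors[of "[]"] regular by (simp add: regular_tree_def)

text \<open>The first letter of \<open>xs\<close> is the parent's color. Repeating it leaves the
  reduced string unchanged and is always admissible; any other admissible color leads to a child of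
  that string.\<close>

lemma sum_child_colors:
  assumes "xs \<noteq> []" and s: "remdups_adj xs \<in> T"
  shows "(\<Sum>c\<in>{c \<in> {1..N}. remdups_adj (c # xs) \<in> T}. if c = hd xs then ratio else 1)
       = ratio * real n"
proof -
  let ?s = "remdups_adj xs" and ?A = "{c \<in> {1..N}. c # remdups_adj xs \<in> T}"
  have rem: "remdups_adj (c # xs) = (if c = hd xs then ?s else c # ?s)" for c
    using assms(1) by (cases xs) auto
  \<comment> \<open>\<open>T\<close> consists of alternating strings, so the repeated color is not
    counted among the children.\<close>
  have "?s = hd xs # tl ?s"
    using assms(1) by (metis hd_remdups_adj list.collapse remdups_adj_Nil_iff)
  then have "\<not> distinct_adj (hd xs # ?s)"
    by (metis distinct_adj_Cons_Cons)
  then have notin: "hd xs \<notin> ?A"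
    using T_alternating by (auto simp: alternating_strings_def)
  have "hd xs \<in> {1..N}"
    using assms T_alternating hd_in_set[OF assms(1)]
    by (auto simp: alternating_strings_def dest!: subsetD)
  then have eq: "{c \<in> {1..N}. remdups_adj (c # xs) \<in> T} = insert (hd xs) ?A"
    using s by (auto simp: rem)
  have "(\<Sum>c\<in>?A. if c = hd xs then ratio else 1) = (\<Sum>c\<in>?A. 1)"
    using notin by (intro sum.cong) auto
  \<comment> \<open>As \<open>xs\<close> is nonempty, its reduction is not the root, whose number of
    children is \<open>n\<close>.\<close>
  moreover have "card ?A = d"
    using card_child_colors[of ?s] regular assms by (simp add: regular_tree_def)
  ultimately have "(\<Sum>c\<in>?A. if c = hd xs then ratio else 1) = real d" by simp
  moreover have "finite ?A" by simp
  ultimately show ?thesis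
    unfolding eq using notin ratio_balance by (subst sum.insert) auto
qed

text \<open>Induction on the number of blocks. An innermost block is colored last, and summing over
  its color gives a factor that is the same for every weak coloring of the other blocks.\<close>

lemma sum_weak_colorings:
  fixes \<pi> :: "'a::linorder set set"
  assumes "\<pi> \<in> NC S" and "finite \<pi>"
  shows "(\<Sum>\<chi>\<in>weak_colorings N \<pi> T. \<Prod>V\<in>\<pi>. if same_color_parent \<pi> \<chi> V then ratio else 1)
       = real n ^ card \<pi> * ratio ^ card (inner_blocks \<pi>)"
  using assms
proof (induction "card \<pi>" arbitrary: \<pi> S)
  case 0
  then have "\<pi> = {}" by simp
  then show ?case by (simp add: weak_colorings_def inner_blocks_def)
next
  case (Suc k)
  then have "\<pi> \<noteq> {}" by auto
  then obtain V where V: "V \<in> \<pi>" "\<And>U. U \<in> \<pi> \<Longrightarrow> \<not> V \<prec> U"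
    using nests_maximal[OF Suc.prems(2)] by metis
  interpret innermost_block S \<pi> V
    using Suc.prems V by unfold_locales
  let ?f = "\<lambda>\<rho> \<chi>. \<Prod>V\<in>\<rho>. if same_color_parent \<rho> \<chi> V then ratio else 1"
  let ?A = "\<lambda>\<chi>. {c \<in> {1..N}. remdups_adj (c # map \<chi> ancestors) \<in> T}"
  let ?x = "if V \<in> inner_blocks \<pi> then ratio * real n else real n"
  have step: "(\<Sum>c\<in>?A \<chi>. ?f \<pi> (\<chi>(V := c))) = ?x * ?f \<pi>' \<chi>"
    if \<chi>: "\<chi> \<in> weak_colorings N \<pi>' T" for \<chi>
  proof -
    let ?w = "\<lambda>c. if V \<in> inner_blocks \<pi> \<and> c = hd (map \<chi> ancestors) then ratio else 1"
    have "?f \<pi> (\<chi>(V := c)) = ?w c * ?f \<pi>' \<chi>" for c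
    proof -
      have "map (\<chi>(V := c)) ancestors = map \<chi> ancestors"
        using ancestors_subset by auto
      then have "same_color_parent \<pi> (\<chi>(V := c)) V \<longleftrightarrow>
          V \<in> inner_blocks \<pi> \<and> c = hd (map \<chi> ancestors)"
        using same_color_parent_iff_hd[OF NC finite block, of "\<chi>(V := c)"]
        by (metis ancestors_def fun_upd_same)
      moreover have "same_color_parent \<pi> (\<chi>(V := c)) U \<longleftrightarrow> same_color_parent \<pi>' \<chi> U"
        if "U \<in> \<pi>'" for U
        using same_color_parent_remove[OF that, of \<chi> "\<chi>(V := c)"] by simp
      ultimately show ?thesis
        by (subst prod.remove[OF finite block]) (auto intro: prod.cong)
    qed
    then have "(\<Sum>c\<in>?A \<chi>. ?f \<pi> (\<chi>(V := c))) = (\<Sum>c\<in>?A \<chi>. ?w c) * ?f \<pi>' \<chi>"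
      by (simp add: sum_distrib_right)
    also have "(\<Sum>c\<in>?A \<chi>. ?w c) = ?x"
    proof (cases "V \<in> inner_blocks \<pi>")
      case True
      then obtain P where P: "covers \<pi> P V"
        using covers_exists finite by blast
      then have P': "P \<in> \<pi>'"
        using nests_irrefl unfolding covers_def by auto
      \<comment> \<open>The string above \<open>V\<close> is the chain of its parent, whose
        reduction lies in \<open>T\<close> because \<chi> is a weak coloring of
        \<open>\<pi>'\<close>.\<close>
      have "ancestors = block_chain \<pi>' P"
        using block_chain_covers[OF NC finite P] block_chain_remove[OF P'] block_chain_ancestors
        by simp
      then have "remdups_adj (map \<chi> ancestors) \<in> T" "ancestors \<noteq> []"
        using \<chi> P' block_chain_ne unfolding weak_colorings_def by auto
      then show ?thesis
        using sum_child_colors[of "map \<chi> ancestors"] True by simp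
    next
      case False
      then have "ancestors = []"
        using block_chain_outer[of V \<pi>] block block_chain_ancestors by simp
      then show ?thesis
        using False card_root_colors by simp
    qed
    finally show ?thesis .
  qed
  have "(\<Sum>\<chi>\<in>weak_colorings N \<pi> T. ?f \<pi> \<chi>) = (\<Sum>\<chi>\<in>weak_colorings N \<pi>' T. ?x * ?f \<pi>' \<chi>)"
    unfolding sum_weak_colorings_remove by (intro sum.cong refl step)
  also have "\<dots> = ?x * (real n ^ card \<pi>' * ratio ^ card (inner_blocks \<pi>'))"
    unfolding sum_distrib_left[symmetric]
    using Suc.hyps(1)[of \<pi>' "\<Union>\<pi>'"] Suc.hyps(2) NC_subset[OF NC, of \<pi>'] block finite
    by (simp add: card_Diff_singleton)
  also have "\<dots> = real n ^ card \<pi> * ratio ^ card (inner_blocks \<pi>)"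
  proof -
    have "real n ^ card \<pi> = real n * real n ^ card \<pi>'"
      unfolding card_Suc_Diff1[OF finite block, symmetric] by (rule power_Suc)
    moreover have "ratio ^ card (inner_blocks \<pi>) =
        (if V \<in> inner_blocks \<pi> then ratio else 1) * ratio ^ card (inner_blocks \<pi>')"
    proof (cases "V \<in> inner_blocks \<pi>")
      case True
      moreover have "finite (inner_blocks \<pi>)"
        using finite by (simp add: inner_blocks_def)
      ultimately have "card (inner_blocks \<pi>) = Suc (card (inner_blocks \<pi>'))"
        unfolding inner_blocks_remove by (intro card_Suc_Diff1[symmetric])
      with True show ?thesis by simp
    qed (simp add: inner_blocks_remove)
    ultimately show ?thesis
      by (cases "V \<in> inner_blocks \<pi>") (simp_all only: if_True if_False mult_ac mult_1_left)
  qed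
  finally show ?case .
qed

section \<open>Solving the system\<close>

text \<open>The value \<open>undefined\<close> off the index set makes the function extensional, as
  \<open>alpha\<close> demands.\<close>

definition solution :: "'a::linorder set set \<Rightarrow> real" where
  "solution \<pi> = (if \<pi> \<in> (\<Union>S\<in>{S. finite S}. NC S)
     then ratio ^ card (inner_blocks \<pi>) else undefined)"

lemma solution_eq:
  assumes "finite S" and "\<pi> \<in> NC S"
  shows "solution \<pi> = ratio ^ card (inner_blocks \<pi>)"
  using assms by (auto simp: solution_def)

lemma component_NC:
  assumes "finite S" and "\<pi> \<in> NC S" and "C \<in> color_components \<pi> \<chi>"
  shows "C \<subseteq> \<pi>" and "finite (\<Union>C)" and "C \<in> NC (\<Union>C)"
proof -
  show sub: "C \<subseteq> \<pi>"
    using color_components_partition[of \<pi> \<chi>] assms(3) unfolding partition_on_def by blast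
  have "\<Union>C \<subseteq> S"
    using sub NC_Union[OF assms(2)] by blast
  then show "finite (\<Union>C)"
    using assms(1) finite_subset by blast
  show "C \<in> NC (\<Union>C)"
    using NC_subset[OF assms(2) sub] .
qed

lemma solution_alpha_system:
  "alpha_system N T (solution :: 'a::linorder set set \<Rightarrow> real)"
  unfolding alpha_system_def card_one_letter
proof (intro allI impI conjI)
  fix S :: "'a set" and \<pi>
  assume S: "finite S" and \<pi>: "\<pi> \<in> NC S"
  then have fin: "finite \<pi>" using finite_NC by blast
  show "solution \<pi> = 1" if one: "card \<pi> = 1"
  proof -
    obtain V where "\<pi> = {V}"
      by (rule card_1_singletonE[OF one])
    \<comment> \<open>A block is not nested in itself, so the exponent is 0 and the power is 1 even
      if \<open>ratio\<close> is 0.\<close>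
    then have "inner_blocks \<pi> = {}"
      using nests_irrefl by (auto simp: inner_blocks_def)
    then show ?thesis
      using solution_eq[OF S \<pi>] by simp
  qed
  have "(\<Prod>C\<in>color_components \<pi> \<chi>. solution C)
      = (\<Prod>V\<in>\<pi>. if same_color_parent \<pi> \<chi> V then ratio else 1)" for \<chi>
    using component_NC[OF S \<pi>] solution_eq
    by (subst prod_color_components[OF \<pi> fin, symmetric]) (intro prod.cong refl, blast)
  then show "solution \<pi> = 1 / real n ^ card \<pi> *
      (\<Sum>\<chi>\<in>weak_colorings N \<pi> T. \<Prod>C\<in>color_components \<pi> \<chi>. solution C)"
    using solution_eq[OF S \<pi>] sum_weak_colorings[OF \<pi> fin] n_ge_2 by simp
qed

text \<open>The unknown \<open>\<alpha> \<pi>\<close> also occurs on the right-hand side of its own equation, but only for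
  the at most \<open>n\<close> constant colorings. If \<open>card \<pi> \<ge> 2\<close>, its total coefficient is thus at most
  \<open>n / n ^ card \<pi> < 1\<close>.\<close>

lemma card_connected_colorings:
  assumes NC: "\<pi> \<in> NC S" and fin: "finite \<pi>" and "V \<in> \<pi>"
  shows "card {\<chi> \<in> weak_colorings N \<pi> T. \<pi> \<in> color_components \<pi> \<chi>} \<le> n"
proof -
  let ?M = "{\<chi> \<in> weak_colorings N \<pi> T. \<pi> \<in> color_components \<pi> \<chi>}"
  \<comment> \<open>If \<pi> is a single component, any two of its blocks are joined by a path of
    constant color.\<close>
  have const: "\<chi> U = \<chi> V" if "\<chi> \<in> ?M" "U \<in> \<pi>" for \<chi> U
    using that assms(3) color_components_rtrancl[of \<pi> \<pi> \<chi> V U]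
      color_edges_rtrancl_in[of V U \<pi> \<chi>] by blast
  have "inj_on (\<lambda>\<chi>. \<chi> V) ?M"
  proof (rule inj_onI)
    fix \<chi> \<chi>' assume *: "\<chi> \<in> ?M" "\<chi>' \<in> ?M" "\<chi> V = \<chi>' V"
    show "\<chi> = \<chi>'"
    proof (rule PiE_ext)
      show "\<chi> \<in> \<pi> \<rightarrow>\<^sub>E {1..N}" "\<chi>' \<in> \<pi> \<rightarrow>\<^sub>E {1..N}"
        using * by (auto simp: weak_colorings_def)
      show "\<chi> U = \<chi>' U" if "U \<in> \<pi>" for U
        using const[OF *(1) that] const[OF *(2) that] *(3) by simp
    qed
  qed
  moreover have "(\<lambda>\<chi>. \<chi> V) ` ?M \<subseteq> {c \<in> {1..N}. [c] \<in> T}"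
  proof
    fix c assume "c \<in> (\<lambda>\<chi>. \<chi> V) ` ?M"
    then obtain \<chi> where \<chi>: "\<chi> \<in> ?M" "c = \<chi> V" by blast
    have "set (block_chain \<pi> V) \<subseteq> \<pi>"
      using set_block_chain[OF NC fin assms(3)] assms(3) by auto
    \<comment> \<open>A constant chain reduces to one letter, so the common color is one of the
      \<open>n\<close> letters at the root.\<close>
    then have "map \<chi> (block_chain \<pi> V) = replicate (length (block_chain \<pi> V)) c"
      using const[OF \<chi>(1)] \<chi>(2) by (intro replicate_eqI) auto
    then have "remdups_adj (map \<chi> (block_chain \<pi> V)) = [c]"
      by (simp add: remdups_adj_replicate block_chain_ne)
    then show "c \<in> {c \<in> {1..N}. [c] \<in> T}"
      using \<chi> assms(3) unfolding weak_colorings_def PiE_def Pi_def by force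
  qed
  ultimately have "card ?M \<le> card {c \<in> {1..N}. [c] \<in> T}"
    by (intro card_inj_on_le) auto
  then show ?thesis
    by (simp only: card_root_colors)
qed

text \<open>Strong induction on the number of blocks. Colorings that split \<pi> into proper
  components contribute equally to both right-hand sides. Subtracting the equations leaves (n ^ card
  \<pi> - m) * \<delta> = 0, where \<delta> is the difference of the two values and m counts the
  colorings with \<pi> as one component.\<close>

lemma alpha_system_unique:
  fixes \<alpha> \<beta> :: "'a::linorder set set \<Rightarrow> real"
  assumes "alpha_system N T \<alpha>" and "alpha_system N T \<beta>" and "finite S" and "\<pi> \<in> NC S"
  shows "\<alpha> \<pi> = \<beta> \<pi>"
  using assms(3,4)
proof (induction "card \<pi>" arbitrary: \<pi> S rule: less_induct)
  case less
  note S = less.prems(1) and \<pi> = less.prems(2)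
  have fin: "finite \<pi>" using finite_NC[OF \<pi> S] .
  have eq: "\<gamma> \<pi> = 1 / real n ^ card \<pi> *
      (\<Sum>\<chi>\<in>weak_colorings N \<pi> T. \<Prod>C\<in>color_components \<pi> \<chi>. \<gamma> C)"
    and one: "card \<pi> = 1 \<Longrightarrow> \<gamma> \<pi> = 1" if "alpha_system N T \<gamma>" for \<gamma>
    using that S \<pi> card_one_letter unfolding alpha_system_def by blast+
  \<comment> \<open>For a single block the equation is a tautology, so the normalization decides.
    The empty partition has no components, so its equation has no unknown on the right.\<close>
  consider "\<pi> = {}" | "card \<pi> = 1" | "card \<pi> \<ge> 2"
    using fin by (cases "card \<pi>" rule: nat.exhaust) (auto simp: Suc_le_eq)
  then show ?case
  proof cases
    case 1
    have "color_components \<pi> \<chi> = {}" for \<chi>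
      using 1 by (simp add: color_components_eq quotient_def)
    then show ?thesis
      using eq[OF assms(1)] eq[OF assms(2)] by simp
  next
    case 2
    then show ?thesis
      using one[OF assms(1)] one[OF assms(2)] by simp
  next
    case 3
    let ?W = "weak_colorings N \<pi> T"
    let ?M = "{\<chi> \<in> ?W. \<pi> \<in> color_components \<pi> \<chi>}"
    let ?\<delta> = "\<alpha> \<pi> - \<beta> \<pi>"
    have finW: "finite ?W"
      unfolding weak_colorings_def using fin by (simp add: finite_PiE)
    have diff: "(\<Prod>C\<in>color_components \<pi> \<chi>. \<alpha> C) - (\<Prod>C\<in>color_components \<pi> \<chi>. \<beta> C)
        = (if \<pi> \<in> color_components \<pi> \<chi> then ?\<delta> else 0)" for \<chi>
    proof (cases "\<pi> \<in> color_components \<pi> \<chi>")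
      case True
      have "C = \<pi>" if C: "C \<in> color_components \<pi> \<chi>" for C
      proof (rule ccontr)
        assume "C \<noteq> \<pi>"
        then have "C \<inter> \<pi> = {}"
          using disjointD[OF partition_onD2[OF color_components_partition] C True] by simp
        then show False
          using component_NC(1)[OF S \<pi> C] partition_onD3[OF color_components_partition] C
          by (metis inf.absorb1)
      qed
      with True have "color_components \<pi> \<chi> = {\<pi>}" by blast
      then show ?thesis by simp
    next
      case False
      have "\<alpha> C = \<beta> C" if C: "C \<in> color_components \<pi> \<chi>" for C
      proof -
        have "C \<subset> \<pi>"
          using component_NC(1)[OF S \<pi> C] C False by blast
        then show ?thesis
          using less.hyps[of C "\<Union>C"] component_NC[OF S \<pi> C] fin psubset_card_mono by blast
      qed
      then show ?thesis
        using False by simp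
    qed
    have "real n ^ card \<pi> * ?\<delta> =
        (\<Sum>\<chi>\<in>?W. (\<Prod>C\<in>color_components \<pi> \<chi>. \<alpha> C) - (\<Prod>C\<in>color_components \<pi> \<chi>. \<beta> C))"
      using eq[OF assms(1)] eq[OF assms(2)] n_ge_2 by (simp add: sum_subtractf field_simps)
    also have "\<dots> = real (card ?M) * ?\<delta>"
      unfolding diff using finW by (simp add: sum.If_cases Int_def)
    finally have "(real n ^ card \<pi> - real (card ?M)) * ?\<delta> = 0"
      by (simp add: algebra_simps)
    \<comment> \<open>Strictness comes from n < n ^ card \<pi>, where both \<open>n\<close> and
      \<open>card \<pi>\<close> are at least 2.\<close>
    moreover have "real (card ?M) < real n ^ card \<pi>"
    proof -
      obtain V where "V \<in> \<pi>" using 3 by fastforce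
      then have "card ?M \<le> n" by (rule card_connected_colorings[OF \<pi> fin])
      also have "n < n ^ card \<pi>"
        using n_ge_2 3 power_strict_increasing[of 1 "card \<pi>" n] by simp
      finally show ?thesis
        by (metis of_nat_less_iff of_nat_power)
    qed
    ultimately show ?thesis by simp
  qed
qed

text \<open>The equations determine the values on the index set and extensionality those outside it,
  so the definite description picks out exactly this function.\<close>

lemma alpha_eq: "alpha N T = (solution :: 'a::linorder set set \<Rightarrow> real)"
  unfolding alpha_def
proof (rule the_equality)
  show "solution \<in> extensional (\<Union>S\<in>{S::'a set. finite S}. NC S) \<and> alpha_system N T solution"
    using solution_alpha_system by (auto simp: extensional_def solution_def)
next
  fix \<alpha> :: "'a set set \<Rightarrow> real"
  assume \<alpha>: "\<alpha> \<in> extensional (\<Union>S\<in>{S. finite S}. NC S) \<and> alpha_system N T \<alpha>"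
  show "\<alpha> = solution"
  proof
    fix \<pi> :: "'a set set"
    show "\<alpha> \<pi> = solution \<pi>"
    proof (cases "\<pi> \<in> (\<Union>S\<in>{S. finite S}. NC S)")
      case True
      then show ?thesis
        using alpha_system_unique[OF _ solution_alpha_system] \<alpha> by blast
    next
      case False
      then show ?thesis
        using \<alpha> by (auto simp: extensional_def solution_def)
    qed
  qed
qed

end

theorem proposition7p25:
  fixes N n d :: nat and T :: "nat list set"
    and S :: "'a::linorder set" and \<pi> :: "'a set set"
  assumes "T \<in> Tree N" and "regular_tree T n d" and "n \<ge> 2"
    and "finite S" and "S \<noteq> {}" and "\<pi> \<in> NC S"
  shows "alpha N T \<pi> = (real d / (real n - 1)) ^ card (inner_blocks \<pi>)"
proof -
  interpret rooted_regular_tree N n d T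
    using assms(1-3) by unfold_locales
  show ?thesis
    by (simp add: alpha_eq solution_eq[OF assms(4,6)] ratio_def)
qed

end
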